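(* For a connected skew shape $\lambda/\mu$, $\mathrm{ED}(\lambda/\mu)\le\mathrm{OOT}(\lambda/\mu)$.
   Context: $[\lambda]=\{(i,j):1\le i\le\ell(\lambda),1\le j\le\lambda_i\}$ (English convention). Excited diagrams: for $D\subseteq[\lambda]$, a cell $(i,j)\in D$ is active if $(i+1,j),(i,j+1),(i+1,j+1)\in[\lambda]\setminus D$; an excited move replaces it by $(i+1,j+1)$. $\mathcal{E}(\lambda/\mu)$ is the set of subsets of $[\lambda]$ obtained from $[\mu]$ by finite sequences of excited moves, $\mathrm{ED}(\lambda/\mu)=|\mathcal{E}(\lambda/\mu)|$. With $d=\ell(\lambda)$, $\mathrm{OOT}(\lambda/\mu)$ is the number of SSYT $T$ of shape $\mu$ (weakly increasing rows, strictly increasing columns) with entries in $\{1,\dots,d\}$ such that $j-i<\lambda_{d+1-T(i,j)}$ for all $(i,j)\in[\mu]$. Throughout the paper skew shapes are assumed connected. *)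

theory Defs
  imports Main "HOL-Library.FuncSet"
begin

text \<open>
  An integer partition is the weakly decreasing list of its positive parts, so \<open>length\<close> is
  the number of parts. Rows, columns and parts are numbered from 1, and \<open>part p i = 0\<close>
  beyond the last part.
\<close>

definition partition :: "nat list \<Rightarrow> bool" where
  "partition p \<longleftrightarrow> sorted_wrt (\<ge>) p \<and> (\<forall>x \<in> set p. x > 0)"

definition part :: "nat list \<Rightarrow> nat \<Rightarrow> nat" where
  "part p i = (if 1 \<le> i \<and> i \<le> length p then p ! (i - 1) else 0)"

definition diagram :: "nat list \<Rightarrow> (nat \<times> nat) set" where
  "diagram p = {(i, j). 1 \<le> i \<and> i \<le> length p \<and> 1 \<le> j \<and> j \<le> part p i}"

definition skew_shape :: "nat list \<Rightarrow> nat list \<Rightarrow> bool" where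
  "skew_shape lam mu \<longleftrightarrow> partition lam \<and> partition mu \<and> diagram mu \<subseteq> diagram lam"

definition adjacent :: "nat \<times> nat \<Rightarrow> nat \<times> nat \<Rightarrow> bool" where
  "adjacent u v \<longleftrightarrow>
     (fst u = fst v \<and> (snd v = Suc (snd u) \<or> snd u = Suc (snd v))) \<or>
     (snd u = snd v \<and> (fst v = Suc (fst u) \<or> fst u = Suc (fst v)))"

definition connected_cells :: "(nat \<times> nat) set \<Rightarrow> bool" where
  "connected_cells S \<longleftrightarrow>
     (\<forall>u \<in> S. \<forall>v \<in> S. (\<lambda>a b. a \<in> S \<and> b \<in> S \<and> adjacent a b)\<^sup>*\<^sup>* u v)"

definition connected_skew_shape :: "nat list \<Rightarrow> nat list \<Rightarrow> bool" where
  "connected_skew_shape lam mu \<longleftrightarrow>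
     skew_shape lam mu \<and> connected_cells (diagram lam - diagram mu)"

definition active :: "nat list \<Rightarrow> (nat \<times> nat) set \<Rightarrow> nat \<Rightarrow> nat \<Rightarrow> bool" where
  "active lam D i j \<longleftrightarrow>
     (i, j) \<in> D \<and> {(i + 1, j), (i, j + 1), (i + 1, j + 1)} \<subseteq> diagram lam - D"

definition excited_move ::
  "nat list \<Rightarrow> (nat \<times> nat) set \<Rightarrow> (nat \<times> nat) set \<Rightarrow> bool" where
  "excited_move lam D D' \<longleftrightarrow>
     (\<exists>i j. active lam D i j \<and> D' = insert (i + 1, j + 1) (D - {(i, j)}))"

definition excited_diagrams :: "nat list \<Rightarrow> nat list \<Rightarrow> (nat \<times> nat) set set" where
  "excited_diagrams lam mu =
     {D. D \<subseteq> diagram lam \<and> (excited_move lam)\<^sup>*\<^sup>* (diagram mu) D}"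

definition ED :: "nat list \<Rightarrow> nat list \<Rightarrow> nat" where
  "ED lam mu = card (excited_diagrams lam mu)"

text \<open>
  Tableaux are extensional functions on the cells of the shape, so that distinct functions are
  distinct tableaux.
\<close>

definition ssyt :: "nat list \<Rightarrow> nat \<Rightarrow> (nat \<times> nat \<Rightarrow> nat) set" where
  "ssyt mu d = {T \<in> diagram mu \<rightarrow>\<^sub>E {1..d}.
     (\<forall>i j. (i, j) \<in> diagram mu \<and> (i, j + 1) \<in> diagram mu \<longrightarrow> T (i, j) \<le> T (i, j + 1)) \<and>
     (\<forall>i j. (i, j) \<in> diagram mu \<and> (i + 1, j) \<in> diagram mu \<longrightarrow> T (i, j) < T (i + 1, j))}"

definition oo_tableaux :: "nat list \<Rightarrow> nat list \<Rightarrow> (nat \<times> nat \<Rightarrow> nat) set" where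
  "oo_tableaux lam mu = {T \<in> ssyt mu (length lam).
     \<forall>(i, j) \<in> diagram mu. int j - int i < int (part lam (length lam + 1 - T (i, j)))}"

definition OOT :: "nat list \<Rightarrow> nat list \<Rightarrow> nat" where
  "OOT lam mu = card (oo_tableaux lam mu)"

end

theory Submission
  imports Defs
begin

text \<open>
  Recording the row reached by each cell of \<open>\<mu>\<close> turns an excited diagram into a semistandard
  tableau \<open>T\<close> in which \<open>(i, j)\<close> has moved to \<open>(T(i,j), j + T(i,j) - i)\<close>. As that cell lies in
  \<open>[\<lambda>]\<close>, the entry \<open>v\<close> occurs only in the first \<open>\<lambda>\<^sub>v\<close> columns of \<open>T\<close>. If instead \<open>v\<close> is
  confined to the first \<open>\<lambda>\<^bsub>d+1-v\<^esub>\<close> columns, then \<open>T\<close> is an Okounkov-Olshanski tableau, because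
  \<open>j - i < j\<close>. It remains to see that reversing a weakly decreasing sequence of column bounds
  does not decrease the number of tableaux. By sorting it suffices to exchange the bounds
  \<open>x \<ge> y\<close> of two consecutive values \<open>v, v + 1\<close>: replacing \<open>v\<close> by \<open>v + 1\<close> in all columns beyond
  \<open>y\<close>, where \<open>v + 1\<close> did not occur, is an injection.
\<close>

text \<open>The list \<open>b\<close> is arbitrary rather than a partition, since the bounds pass
  through unsorted orders on the way from \<open>lam\<close> to \<open>rev lam\<close>. Its length
  also serves as the largest allowed entry.\<close>

definition column_bounded_ssyt :: "nat list \<Rightarrow> nat list \<Rightarrow> (nat \<times> nat \<Rightarrow> nat) set" where
  "column_bounded_ssyt mu b =
     {T \<in> ssyt mu (length b). \<forall>(i, j) \<in> diagram mu. j \<le> part b (T (i, j))}"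

lemma finite_diagram: "finite (diagram p)"
proof -
  have "diagram p \<subseteq> Sigma {1..length p} (\<lambda>i. {1..part p i})"
    by (auto simp: diagram_def)
  then show ?thesis
    by (rule finite_subset) auto
qed

lemma finite_ssyt: "finite (ssyt mu d)"
  by (rule finite_subset[of _ "diagram mu \<rightarrow>\<^sub>E {1..d}"])
    (auto simp: ssyt_def intro: finite_PiE finite_diagram)

lemma finite_column_bounded_ssyt: "finite (column_bounded_ssyt mu b)"
  by (rule finite_subset[OF _ finite_ssyt]) (auto simp: column_bounded_ssyt_def)

lemma ssytD:
  assumes "T \<in> ssyt mu d"
  shows ssyt_range: "u \<in> diagram mu \<Longrightarrow> 1 \<le> T u \<and> T u \<le> d"
    and ssyt_undefined: "u \<notin> diagram mu \<Longrightarrow> T u = undefined"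
    and ssyt_row: "(i, j) \<in> diagram mu \<Longrightarrow> (i, Suc j) \<in> diagram mu \<Longrightarrow> T (i, j) \<le> T (i, Suc j)"
    and ssyt_col: "(i, j) \<in> diagram mu \<Longrightarrow> (Suc i, j) \<in> diagram mu \<Longrightarrow> T (i, j) < T (Suc i, j)"
  using assms by (auto simp: ssyt_def PiE_iff intro: extensional_arb)

lemma ssytI:
  assumes "\<And>u. u \<in> diagram mu \<Longrightarrow> 1 \<le> T u \<and> T u \<le> d"
    and "\<And>u. u \<notin> diagram mu \<Longrightarrow> T u = undefined"
    and "\<And>i j. (i, j) \<in> diagram mu \<Longrightarrow> (i, Suc j) \<in> diagram mu \<Longrightarrow> T (i, j) \<le> T (i, Suc j)"
    and "\<And>i j. (i, j) \<in> diagram mu \<Longrightarrow> (Suc i, j) \<in> diagram mu \<Longrightarrow> T (i, j) < T (Suc i, j)"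
  shows "T \<in> ssyt mu d"
  using assms by (auto simp: ssyt_def PiE_iff extensional_def)

section \<open>Rearranging column bounds\<close>

lemma part_append_swap:
  "part (xs @ y # x # ys) v =
     (if v = Suc (length xs) then y
      else if v = Suc (Suc (length xs)) then x
      else part (xs @ x # y # ys) v)"
proof (cases "v \<le> Suc (Suc (length xs))")
  case True
  then show ?thesis
    by (auto simp: part_def nth_append nth_Cons' le_Suc_eq Suc_le_eq)
next
  case False
  then obtain k where "v = length xs + 3 + k"
    by (metis Suc3_eq_add_3 add.commute le_Suc_ex not_less_eq_eq add_Suc)
  then show ?thesis
    by (auto simp: part_def nth_append numeral_3_eq_3)
qed

lemma card_column_bounded_ssyt_swap:
  assumes "y \<le> x"
  shows "card (column_bounded_ssyt mu (xs @ x # y # ys))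
    \<le> card (column_bounded_ssyt mu (xs @ y # x # ys))"
proof -
  define v where "v = Suc (length xs)"
  define b where "b = xs @ x # y # ys"
  define b' where "b' = xs @ y # x # ys"
  define f :: "(nat \<times> nat \<Rightarrow> nat) \<Rightarrow> nat \<times> nat \<Rightarrow> nat"
    where "f T u = (if u \<in> diagram mu \<and> y < snd u \<and> T u = v then Suc v else T u)" for T u
  have part_b: "part b v = x" "part b (Suc v) = y"
    by (auto simp: b_def v_def part_def nth_append)
  have part_b': "part b' w = (if w = v then y else if w = Suc v then x else part b w)" for w
    unfolding b_def b'_def v_def by (rule part_append_swap)
  have len: "length b' = length b" and v_less: "Suc v \<le> length b"
    by (auto simp: b_def b'_def v_def)
  have avoid: "T u \<noteq> Suc v"
    if "T \<in> column_bounded_ssyt mu b" "u \<in> diagram mu" "y < snd u" for T u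
  proof -
    have "snd u \<le> part b (T u)"
      using that(1,2) by (cases u) (auto simp: column_bounded_ssyt_def)
    then show ?thesis
      using that(3) part_b by auto
  qed
  have "f ` column_bounded_ssyt mu b \<subseteq> column_bounded_ssyt mu b'"
  proof safe
    fix T assume T: "T \<in> column_bounded_ssyt mu b"
    then have ssyt: "T \<in> ssyt mu (length b)"
      and bound: "\<And>i j. (i, j) \<in> diagram mu \<Longrightarrow> j \<le> part b (T (i, j))"
      by (auto simp: column_bounded_ssyt_def)
    have "f T \<in> ssyt mu (length b')"
    proof (rule ssytI)
      fix u assume "u \<in> diagram mu"
      then show "1 \<le> f T u \<and> f T u \<le> length b'"
        using ssyt_range[OF ssyt] v_less by (auto simp: f_def len)
    next
      fix u assume "u \<notin> diagram mu"
      then show "f T u = undefined"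
        using ssyt_undefined[OF ssyt] by (auto simp: f_def)
    next
      fix i j assume "(i, j) \<in> diagram mu" "(i, Suc j) \<in> diagram mu"
      \<comment> \<open>If the left entry \<open>v\<close> is raised, its column exceeds
        \<open>y\<close>, hence so does the next one, and a \<open>v\<close> there is raised
        too.\<close>
      then show "f T (i, j) \<le> f T (i, Suc j)"
        using ssyt_row[OF ssyt, of i j] by (auto simp: f_def)
    next
      fix i j assume "(i, j) \<in> diagram mu" "(Suc i, j) \<in> diagram mu"
      \<comment> \<open>A raised \<open>v\<close> could only clash with \<open>Suc v\<close>
        directly below it, in the same column beyond \<open>y\<close>, which \<open>avoid\<close>
        excludes.\<close>
      then show "f T (i, j) < f T (Suc i, j)"
        using ssyt_col[OF ssyt, of i j] avoid[OF T, of "(Suc i, j)"] by (auto simp: f_def)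
    qed
    \<comment> \<open>Remaining entries \<open>v\<close> lie in the first \<open>y\<close> columns.
      An entry \<open>Suc v\<close> was either \<open>v\<close>, with bound \<open>x\<close>, or
      already \<open>Suc v\<close>, with bound \<open>y \<le> x\<close>.\<close>
    moreover have "j \<le> part b' (f T (i, j))" if "(i, j) \<in> diagram mu" for i j
      using bound[OF that] that assms part_b by (auto simp: f_def part_b')
    ultimately show "f T \<in> column_bounded_ssyt mu b'"
      by (auto simp: column_bounded_ssyt_def)
  qed
  \<comment> \<open>Beyond column \<open>y\<close> every \<open>Suc v\<close> in the image was a
    \<open>v\<close>, so \<open>f\<close> can be undone.\<close>
  moreover have "inj_on f (column_bounded_ssyt mu b)"
  proof (rule inj_onI, rule ext)
    fix S T u
    assume S: "S \<in> column_bounded_ssyt mu b" and T: "T \<in> column_bounded_ssyt mu b"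
      and "f S = f T"
    then have "f S u = f T u" by simp
    then show "S u = T u"
      using avoid[OF S, of u] avoid[OF T, of u] by (auto simp: f_def split: if_splits)
  qed
  ultimately show ?thesis
    using card_inj_on_le finite_column_bounded_ssyt unfolding b_def b'_def by blast
qed

text \<open>The bound \<open>x\<close> bubbles to the right end; each exchange passes a bound not
  exceeding it.\<close>

lemma card_column_bounded_ssyt_move:
  assumes "\<forall>z \<in> set zs. z \<le> x"
  shows "card (column_bounded_ssyt mu (xs @ x # zs))
    \<le> card (column_bounded_ssyt mu (xs @ zs @ [x]))"
  using assms
proof (induction zs arbitrary: xs)
  case Nil
  then show ?case by simp
next
  case (Cons z zs)
  have "card (column_bounded_ssyt mu (xs @ x # z # zs))
      \<le> card (column_bounded_ssyt mu (xs @ z # x # zs))"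
    using Cons.prems by (intro card_column_bounded_ssyt_swap) auto
  also have "\<dots> \<le> card (column_bounded_ssyt mu (xs @ (z # zs) @ [x]))"
    using Cons.IH[of "xs @ [z]"] Cons.prems by simp
  finally show ?case .
qed

text \<open>Insertion sort: reverse the tail behind the fixed prefix \<open>xs @ [z]\<close>, then
  carry the largest bound \<open>z\<close> to the end.\<close>

lemma card_column_bounded_ssyt_rev:
  assumes "sorted_wrt (\<ge>) zs"
  shows "card (column_bounded_ssyt mu (xs @ zs)) \<le> card (column_bounded_ssyt mu (xs @ rev zs))"
  using assms
proof (induction zs arbitrary: xs)
  case Nil
  then show ?case by simp
next
  case (Cons z zs)
  have "card (column_bounded_ssyt mu (xs @ z # zs))
      \<le> card (column_bounded_ssyt mu (xs @ z # rev zs))"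
    using Cons.IH[of "xs @ [z]"] Cons.prems by simp
  also have "\<dots> \<le> card (column_bounded_ssyt mu (xs @ rev (z # zs)))"
    using card_column_bounded_ssyt_move[of "rev zs" z mu xs] Cons.prems by simp
  finally show ?case .
qed

lemma part_rev:
  assumes "1 \<le> v" "v \<le> length b"
  shows "part (rev b) v = part b (length b + 1 - v)"
  using assms by (auto simp: part_def rev_nth)

lemma column_bounded_ssyt_rev_subset: "column_bounded_ssyt mu (rev lam) \<subseteq> oo_tableaux lam mu"
proof
  fix T assume T: "T \<in> column_bounded_ssyt mu (rev lam)"
  then have ssyt: "T \<in> ssyt mu (length lam)"
    by (simp add: column_bounded_ssyt_def)
  have "int j - int i < int (part lam (length lam + 1 - T (i, j)))"
    if ij: "(i, j) \<in> diagram mu" for i j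
  proof -
    have "j \<le> part (rev lam) (T (i, j))"
      using T ij by (auto simp: column_bounded_ssyt_def)
    then show ?thesis
      using part_rev[of "T (i, j)" lam] ssyt_range[OF ssyt ij] ij by (auto simp: diagram_def)
  qed
  then show "T \<in> oo_tableaux lam mu"
    using ssyt by (auto simp: oo_tableaux_def)
qed

section \<open>Excited diagrams as tableaux\<close>

lemma part_antimono:
  assumes "partition p" "1 \<le> i" "i \<le> i'"
  shows "part p i' \<le> part p i"
proof (cases "i = i' \<or> length p < i'")
  case False
  then show ?thesis
    using assms sorted_wrt_nth_less[of "(\<ge>)" p "i - 1" "i' - 1"]
    by (auto simp: partition_def part_def)
qed (auto simp: part_def)

lemma diagram_lower_set:
  assumes "partition p" "(i', j') \<in> diagram p" "1 \<le> i" "i \<le> i'" "1 \<le> j" "j \<le> j'"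
  shows "(i, j) \<in> diagram p"
  using assms part_antimono[of p i i'] by (auto simp: diagram_def)

text \<open>A diagonal step is a weak step right followed by a strict step down; the corner between
  them lies in the diagram.\<close>

lemma ssyt_diagonal_less:
  assumes "partition mu" and T: "T \<in> ssyt mu d"
    and "1 \<le> i" "1 \<le> j" "(i + Suc k, j + Suc k) \<in> diagram mu"
  shows "T (i, j) < T (i + Suc k, j + Suc k)"
  using assms(5)
proof (induction k)
  have step: "T (a, c) < T (Suc a, Suc c)"
    if "(Suc a, Suc c) \<in> diagram mu" "1 \<le> a" "1 \<le> c" for a c
  proof -
    have "(a, c) \<in> diagram mu" "(a, Suc c) \<in> diagram mu"
      using that diagram_lower_set[OF assms(1) that(1)] by auto
    then show ?thesis
      using ssyt_row[OF T, of a c] ssyt_col[OF T, of a "Suc c"] that by simp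
  qed
  {
    case 0
    then show ?case using step[of i j] assms by simp
  next
    case (Suc k)
    have "(i + Suc k, j + Suc k) \<in> diagram mu"
      using diagram_lower_set[OF assms(1) Suc.prems] assms by simp
    then show ?case
      using Suc step[of "i + Suc k" "j + Suc k"] by simp
  }
qed

text \<open>The truncated subtraction is harmless: only tableaux with \<open>i \<le> T (i, j)\<close> occur below.\<close>

definition excited_cell :: "(nat \<times> nat \<Rightarrow> nat) \<Rightarrow> nat \<times> nat \<Rightarrow> nat \<times> nat" where
  "excited_cell T u = (T u, snd u + (T u - fst u))"

text \<open>Cells only travel along their diagonals, so two cells with the same image share a
  diagonal, where \<open>T\<close> is strictly increasing.\<close>

lemma inj_on_excited_cell:
  assumes "partition mu" and T: "T \<in> ssyt mu d"
    and ge: "\<And>i j. (i, j) \<in> diagram mu \<Longrightarrow> i \<le> T (i, j)"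
  shows "inj_on (excited_cell T) (diagram mu)"
proof -
  have *: "\<not> i < i'" if "(i, j) \<in> diagram mu" "(i', j') \<in> diagram mu"
    "excited_cell T (i, j) = excited_cell T (i', j')" for i j i' j'
  proof
    assume "i < i'"
    then obtain k where k: "i' = i + Suc k"
      using less_imp_Suc_add by auto
    then have "j' = j + Suc k"
      using that ge[OF that(1)] ge[OF that(2)] by (auto simp: excited_cell_def)
    then show False
      using ssyt_diagonal_less[OF assms(1) T, of i j k] that k
      by (auto simp: diagram_def excited_cell_def)
  qed
  show ?thesis
  proof (rule inj_onI, clarify)
    fix i j i' j'
    assume ij: "(i, j) \<in> diagram mu" "(i', j') \<in> diagram mu"
      and eq: "excited_cell T (i, j) = excited_cell T (i', j')"
    then have "i = i'"
      using *[OF ij] *[OF ij(2,1)] by (metis linorder_neqE_nat)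
    with eq show "i = i' \<and> j = j'"
      by (auto simp: excited_cell_def)
  qed
qed

text \<open>Induction on the moves: start from the tableau with \<open>T (i, j) = i\<close> and let
  each move raise one entry by 1. Emptiness of the neighbouring cells keeps the tableau
  semistandard.\<close>

lemma excited_diagram_tableau:
  assumes "skew_shape lam mu" "(excited_move lam)\<^sup>*\<^sup>* (diagram mu) D"
  shows "\<exists>T \<in> ssyt mu (length lam). (\<forall>(i, j) \<in> diagram mu. i \<le> T (i, j)) \<and>
    D = excited_cell T ` diagram mu \<and> D \<subseteq> diagram lam"
  using assms(2)
proof (induction rule: rtranclp_induct)
  case base
  have sub: "diagram mu \<subseteq> diagram lam"
    using assms by (simp add: skew_shape_def)
  define T :: "nat \<times> nat \<Rightarrow> nat" where "T = restrict fst (diagram mu)"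
  have "T \<in> ssyt mu (length lam)"
    using sub by (intro ssytI) (auto simp: T_def diagram_def)
  moreover have "diagram mu = excited_cell T ` diagram mu"
    by (auto simp: T_def excited_cell_def image_iff Bex_def)
  moreover have "\<forall>(i, j) \<in> diagram mu. i \<le> T (i, j)"
    by (auto simp: T_def)
  ultimately show ?case
    using sub by blast
next
  case (step D D')
  then obtain T where T: "T \<in> ssyt mu (length lam)"
    and ge: "\<And>i j. (i, j) \<in> diagram mu \<Longrightarrow> i \<le> T (i, j)"
    and D: "D = excited_cell T ` diagram mu" "D \<subseteq> diagram lam"
    by auto
  obtain p q where act: "active lam D p q" and D': "D' = insert (p + 1, q + 1) (D - {(p, q)})"
    using step.hyps by (auto simp: excited_move_def)
  then obtain i j where ij: "(i, j) \<in> diagram mu" and pq: "(p, q) = excited_cell T (i, j)"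
    using D by (auto simp: active_def)
  define T' where "T' = T((i, j) := Suc (T (i, j)))"
  have p: "p = T (i, j)" and q: "q = j + (T (i, j) - i)"
    using pq by (auto simp: excited_cell_def)
  have free: "(Suc p, q) \<notin> D" "(p, Suc q) \<notin> D" and lam: "(Suc p, Suc q) \<in> diagram lam"
    using act by (auto simp: active_def)
  \<comment> \<open>An equal entry to the right would put that cell at \<open>(p, Suc q)\<close>,
    which is empty.\<close>
  have row: "T (i, j) < T (i, Suc j)" if "(i, Suc j) \<in> diagram mu"
  proof (rule ccontr)
    assume "\<not> ?thesis"
    then have "excited_cell T (i, Suc j) = (p, Suc q)"
      using ssyt_row[OF T ij that] by (auto simp: excited_cell_def p q)
    then show False
      using free that D by (metis imageI)
  qed
  \<comment> \<open>An entry \<open>Suc p\<close> below would put that cell at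
    \<open>(Suc p, q)\<close>, since its row and its entry both grow by 1.\<close>
  have col: "Suc (T (i, j)) < T (Suc i, j)" if "(Suc i, j) \<in> diagram mu"
  proof (rule ccontr)
    assume "\<not> ?thesis"
    then have "excited_cell T (Suc i, j) = (Suc p, q)"
      using ssyt_col[OF T ij that] by (auto simp: excited_cell_def p q)
    then show False
      using free that D by (metis imageI)
  qed
  have "T' \<in> ssyt mu (length lam)"
  proof (rule ssytI)
    fix u assume "u \<in> diagram mu"
    \<comment> \<open>The target \<open>(Suc p, Suc q)\<close> lies in \<open>diagram lam\<close>,
      so the raised entry \<open>Suc p\<close> is at most \<open>length lam\<close>.\<close>
    then show "1 \<le> T' u \<and> T' u \<le> length lam"
      using ssyt_range[OF T, of u] lam by (auto simp: T'_def p diagram_def)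
  next
    fix u assume "u \<notin> diagram mu"
    then show "T' u = undefined"
      using ssyt_undefined[OF T] ij by (auto simp: T'_def)
  next
    fix a c assume "(a, c) \<in> diagram mu" "(a, Suc c) \<in> diagram mu"
    then show "T' (a, c) \<le> T' (a, Suc c)"
      using ssyt_row[OF T, of a c] row by (auto simp: T'_def)
  next
    fix a c assume "(a, c) \<in> diagram mu" "(Suc a, c) \<in> diagram mu"
    then show "T' (a, c) < T' (Suc a, c)"
      using ssyt_col[OF T, of a c] col by (auto simp: T'_def)
  qed
  moreover have "\<forall>(a, c) \<in> diagram mu. a \<le> T' (a, c)"
    using ge by (fastforce simp: T'_def)
  moreover have "D' = excited_cell T' ` diagram mu"
  proof -
    \<comment> \<open>By injectivity, deleting \<open>(p, q)\<close> from \<open>D\<close> discards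
      the image of \<open>(i, j)\<close> and of no other cell.\<close>
    have "inj_on (excited_cell T) (diagram mu)"
      using assms(1) by (intro inj_on_excited_cell[OF _ T] ge) (auto simp: skew_shape_def)
    then have "D - {(p, q)} = excited_cell T ` (diagram mu - {(i, j)})"
      using ij by (simp add: D pq inj_on_image_set_diff)
    also have "\<dots> = excited_cell T' ` (diagram mu - {(i, j)})"
      by (rule image_cong) (auto simp: T'_def excited_cell_def)
    finally have "D - {(p, q)} = excited_cell T' ` (diagram mu - {(i, j)})" .
    moreover have "(p + 1, q + 1) = excited_cell T' (i, j)"
      using ge[OF ij] by (auto simp: T'_def excited_cell_def p q)
    ultimately show ?thesis
      using ij by (metis D' image_insert insert_Diff)
  qed
  moreover have "D' \<subseteq> diagram lam"
    using D D' lam by auto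
  ultimately show ?case by blast
qed

text \<open>A cell's column does not decrease as it moves, so \<open>j\<close> is at most the column
  reached, hence at most the length of row \<open>T (i, j)\<close> of \<open>lam\<close>.
  Surjectivity onto the excited diagrams is all that the cardinality bound requires.\<close>

lemma excited_diagrams_subset:
  assumes "skew_shape lam mu"
  shows "excited_diagrams lam mu
    \<subseteq> (\<lambda>T. excited_cell T ` diagram mu) ` column_bounded_ssyt mu lam"
proof
  fix D assume "D \<in> excited_diagrams lam mu"
  then obtain T where T: "T \<in> ssyt mu (length lam)"
    and D: "D = excited_cell T ` diagram mu" "D \<subseteq> diagram lam"
    using excited_diagram_tableau[OF assms, of D] by (auto simp: excited_diagrams_def)
  have "j \<le> part lam (T (i, j))" if "(i, j) \<in> diagram mu" for i j
  proof -
    have "excited_cell T (i, j) \<in> diagram lam"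
      using D that by blast
    then show ?thesis
      by (auto simp: excited_cell_def diagram_def)
  qed
  then have "T \<in> column_bounded_ssyt mu lam"
    using T by (auto simp: column_bounded_ssyt_def)
  with D show "D \<in> (\<lambda>T. excited_cell T ` diagram mu) ` column_bounded_ssyt mu lam"
    by blast
qed

theorem theorem5p1:
  fixes lam mu :: "nat list"
  assumes "connected_skew_shape lam mu"
  shows "ED lam mu \<le> OOT lam mu"
proof -
  have skew: "skew_shape lam mu"
    using assms by (simp add: connected_skew_shape_def)
  have "ED lam mu \<le> card (column_bounded_ssyt mu lam)"
    unfolding ED_def
    by (rule surj_card_le[OF finite_column_bounded_ssyt excited_diagrams_subset[OF skew]])
  also have "\<dots> \<le> card (column_bounded_ssyt mu (rev lam))"
    using card_column_bounded_ssyt_rev[of lam mu "[]"] skew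
    by (simp add: skew_shape_def partition_def)
  also have "\<dots> \<le> OOT lam mu"
    unfolding OOT_def
    by (rule card_mono[OF _ column_bounded_ssyt_rev_subset])
      (rule finite_subset[OF _ finite_ssyt], auto simp: oo_tableaux_def)
  finally show ?thesis .
qed

end
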